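(* Let $\mathbb{F}$ be a field, let $p\in\mathbb{F}[x]$ be a monic polynomial that is irreducible and separable with $\deg(p)=s$, and let $G=\mathrm{diag}(G_1,\ldots,G_m)$ be a generalized Jordan matrix of the first kind with blocks $G_i\in M_{s\alpha_i}(\mathbb{F})$, generalized Segre characteristic $\alpha=(\alpha_1,\ldots,\alpha_m)$, characteristic polynomial $p_G=p^r$ and minimal polynomial $m_G=p^{r_1}$, $r_1\le r$. If $X\in Z(G)$, then $X=[X_{i,j}]_{i,j=1,\ldots,m}$, where each $X_{i,j}\in M_{s\alpha_i\times s\alpha_j}(\mathbb{F})$ is a block lower triangular Toeplitz matrix (with respect to its partition into $s\times s$ blocks) of the following form: 1) If $\alpha_i=\alpha_j$, then $X_{i,j}\in Z(G_i)$. 2) If $\alpha_i<\alpha_j$, then $X_{i,j}=\begin{bmatrix} Y_{i,j} & 0\end{bmatrix}$ for some $Y_{i,j}\in Z(G_i)$. 3) If $\alpha_i>\alpha_j$, then $X_{i,j}=\begin{bmatrix} 0\\ Y_{i,j}\end{bmatrix}$ for some $Y_{i,j}\in Z(G_j)$.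
   Context: For a square matrix $A\in M_n(\mathbb{F})$, $Z(A)=\{B\in M_n(\mathbb{F}): AB=BA\}$ is the centralizer of $A$. Let $p=x^s+c_{s-1}x^{s-1}+\cdots+c_1x+c_0\in\mathbb{F}[x]$. Its companion matrix $C\in M_s(\mathbb{F})$ has ones on the first subdiagonal, last column $(-c_0,-c_1,\ldots,-c_{s-1})^T$, and zeros elsewhere. A generalized Jordan block of the first kind $G_i\in M_{s\alpha_i}(\mathbb{F})$ is the $\alpha_i\times\alpha_i$ block matrix with $s\times s$ blocks having $C$ in every diagonal block, the identity matrix $I$ in every block of the first block subdiagonal, and $0$ elsewhere. A generalized Jordan matrix of the first kind is $G=\mathrm{diag}(G_1,\ldots,G_m)$, all $G_i$ built from the same $p$, with $\alpha_1\ge\alpha_2\ge\cdots\ge\alpha_m\ge0$ and $\sum_i\alpha_i=r$; $\alpha=(\alpha_1,\ldots,\alpha_m)$ is its generalized Segre characteristic. A (possibly rectangular) block matrix $[T_{k,l}]$ with $s\times s$ blocks is block lower triangular Toeplitz if $T_{k,l}$ depends only on $k-l$ and $T_{k,l}=0$ whenever $l>k$. *)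

theory Defs
  imports
    "Jordan_Normal_Form.Char_Poly"
    "Jordan_Normal_Form.DL_Submatrix"
    "Berlekamp_Zassenhaus.Poly_Mod"
begin

text \<open>
  The polynomial predicate \<open>separable\<close> is the one of the AFP entry Polynomial_Factorization:
  \<open>separable f\<close> means \<open>coprime f (pderiv f)\<close>.  Block and matrix indices start at 0.
\<close>

definition centralizer_mat :: "'a :: semiring_0 mat \<Rightarrow> 'a mat set" where
  "centralizer_mat A = {B \<in> carrier_mat (dim_row A) (dim_row A). A * B = B * A}"

text \<open>
  The last column takes precedence over the subdiagonal; the leading coefficient of \<open>p\<close> is not
  used, so this is meant for monic \<open>p\<close>.
\<close>

definition companion_mat :: "'a :: comm_ring_1 poly \<Rightarrow> 'a mat" where
  "companion_mat p = mat (degree p) (degree p) (\<lambda>(i, j).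
     if Suc j = degree p then - coeff p i else if i = Suc j then 1 else 0)"

text \<open>
  Row \<open>i\<close> of an array of \<open>s \<times> s\<close> blocks is row \<open>i mod s\<close> of block row \<open>i div s\<close>, and likewise
  for columns.
\<close>

definition gen_jordan_block :: "'a :: comm_ring_1 poly \<Rightarrow> nat \<Rightarrow> 'a mat" where
  "gen_jordan_block p a = (let s = degree p in mat (s * a) (s * a) (\<lambda>(i, j).
     if i div s = j div s then companion_mat p $$ (i mod s, j mod s)
     else if i div s = Suc (j div s) then 1\<^sub>m s $$ (i mod s, j mod s)
     else 0))"

definition gen_jordan_mat :: "'a :: comm_ring_1 poly \<Rightarrow> nat list \<Rightarrow> 'a mat" where
  "gen_jordan_mat p \<alpha> = diag_block_mat (map (gen_jordan_block p) \<alpha>)"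

text \<open>\<open>f(A) = \<Sum>k. coeff f k \<cdot> A\<^sup>k\<close>, entry by entry, for a square matrix \<open>A\<close>.\<close>

definition eval_poly_mat :: "'a :: comm_semiring_1 poly \<Rightarrow> 'a mat \<Rightarrow> 'a mat" where
  "eval_poly_mat f A = mat (dim_row A) (dim_row A)
     (\<lambda>ij. \<Sum>k\<le>degree f. coeff f k * (A ^\<^sub>m k) $$ ij)"

definition is_minimal_poly :: "'a :: field mat \<Rightarrow> 'a poly \<Rightarrow> bool" where
  "is_minimal_poly A q \<longleftrightarrow>
     lead_coeff q = 1 \<and> eval_poly_mat q A = 0\<^sub>m (dim_row A) (dim_row A) \<and>
     (\<forall>f. f \<noteq> 0 \<and> eval_poly_mat f A = 0\<^sub>m (dim_row A) (dim_row A) \<longrightarrow> degree q \<le> degree f)"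

text \<open>
  The block \<open>(i, j)\<close> of a matrix partitioned into \<open>length \<rho>\<close> block rows of heights \<open>\<rho> ! i\<close> and
  \<open>length \<kappa>\<close> block columns of widths \<open>\<kappa> ! j\<close>.
\<close>

definition mat_block :: "nat list \<Rightarrow> nat list \<Rightarrow> 'a mat \<Rightarrow> nat \<Rightarrow> nat \<Rightarrow> 'a mat" where
  "mat_block \<rho> \<kappa> X i j = submatrix X
     {sum_list (take i \<rho>) ..< sum_list (take (Suc i) \<rho>)}
     {sum_list (take j \<kappa>) ..< sum_list (take (Suc j) \<kappa>)}"

text \<open>\<open>T\<close> is an \<open>a \<times> b\<close> array of \<open>s \<times> s\<close> blocks.\<close>

definition block_lower_toeplitz :: "nat \<Rightarrow> nat \<Rightarrow> nat \<Rightarrow> 'a :: zero mat \<Rightarrow> bool" where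
  "block_lower_toeplitz s a b T \<longleftrightarrow>
     T \<in> carrier_mat (s * a) (s * b) \<and>
     (let B = mat_block (replicate a s) (replicate b s) T in
        (\<forall>k<a. \<forall>l<b. \<forall>k'<a. \<forall>l'<b. int k - int l = int k' - int l' \<longrightarrow> B k l = B k' l') \<and>
        (\<forall>k<a. \<forall>l<b. k < l \<longrightarrow> B k l = 0\<^sub>m s s))"

text \<open>The column analogue \<open>[A B]\<close> of \<open>append_rows\<close>.\<close>

definition append_cols :: "'a :: zero mat \<Rightarrow> 'a mat \<Rightarrow> 'a mat" where
  "append_cols A B = four_block_mat A B (0\<^sub>m 0 (dim_col A)) (0\<^sub>m 0 (dim_col B))"

end

theory Submission
  imports Defs
begin

text \<open>
  Reading \<open>G X = X G\<close> block by block, every \<open>T = X\<^sub>i\<^sub>j\<close> satisfies \<open>G\<^sub>i T = T G\<^sub>j\<close>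
  (\<open>diag_block_mat_centralizer_block\<close>). Cut \<open>T\<close> further into \<open>s \<times> s\<close> blocks \<open>B\<^sub>k\<^sub>l\<close>. With blocks outside the
  array read as zero, the equation becomes
  \<open>C B\<^sub>k\<^sub>l - B\<^sub>k\<^sub>l C = B\<^sub>k\<^sub>,\<^sub>l\<^sub>+\<^sub>1 - B\<^sub>k\<^sub>-\<^sub>1\<^sub>,\<^sub>l\<close> (\<open>gen_jordan_intertwine_blocks\<close>).

  The point is that both sides are zero, and this is where separability enters. If \<open>D = C B - B C\<close>
  commutes with \<open>C\<close>, then \<open>f(C) B - B f(C) = f'(C) D\<close> for every polynomial \<open>f\<close>. Taking \<open>f = p\<close> and using
  \<open>p(C) = 0\<close> gives \<open>p'(C) D = 0\<close>; as \<open>p\<close> and \<open>p'\<close> are coprime, \<open>p'(C)\<close> is invertible, so \<open>D = 0\<close>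
  (\<open>separable_commutator_zero\<close>). Starting at the upper right corner of the array, where the
  right-hand side is zero, induction shows that all \<open>B\<^sub>k\<^sub>l\<close> commute with \<open>C\<close> and that
  \<open>B\<^sub>k\<^sub>,\<^sub>l\<^sub>+\<^sub>1 = B\<^sub>k\<^sub>-\<^sub>1\<^sub>,\<^sub>l\<close> throughout (\<open>commuting_blocks\<close>).

  What remains is combinatorial. Blocks are constant along diagonals, and a diagonal consists of
  zeros if it starts in the top row to the right of the corner or ends in the last column above the
  bottom row (\<open>toeplitz_grid\<close>). Hence \<open>T\<close> is block lower triangular Toeplitz, with
  \<open>\<alpha>\<^sub>j - \<alpha>\<^sub>i\<close> zero block columns on the right or \<open>\<alpha>\<^sub>i - \<alpha>\<^sub>j\<close> zero block rows on top. Deleting these leaves a square matrix \<open>Y\<close> that commutes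
  with the smaller of the two Jordan blocks, because a generalized Jordan block contains the smaller
  ones as leading and as trailing submatrices.
\<close>

section \<open>Polynomials of a matrix and their commutators\<close>

text \<open>
  A descent through division with remainder. No normalized gcds are involved, so that the result covers
  polynomials over an arbitrary field.
\<close>
lemma coprime_imp_bezout:
  fixes a b :: "'a :: euclidean_ring"
  assumes "Rings.coprime a b"
  shows "\<exists>u v. u * a + v * b = 1"
  using assms
proof (induction "euclidean_size b" arbitrary: a b rule: less_induct)
  case less
  show ?case
  proof (cases "b = 0")
    case True
    then have "a dvd 1" using less.prems by simp
    then show ?thesis using True by (auto elim!: dvdE simp: mult.commute)
  next
    case False
    have "Rings.coprime b (a mod b)"
    proof (rule Rings.coprimeI)
      fix c assume c: "c dvd b" "c dvd a mod b"
      then have "c dvd a" by (simp add: dvd_mod_iff)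
      with less.prems show "is_unit c" using c(1) by (rule Rings.coprime_common_divisor)
    qed
    then obtain u v where uv: "u * b + v * (a mod b) = 1"
      using less.hyps[of "a mod b" b] mod_size_less[OF False] by blast
    have "a mod b = a - a div b * b" by (simp add: minus_div_mult_eq_mod)
    with uv have "v * a + (u - v * (a div b)) * b = 1" by (simp add: algebra_simps)
    then show ?thesis by blast
  qed
qed

lemma mult_mat_index_sum:
  assumes "A \<in> carrier_mat m n" "B \<in> carrier_mat n k" "i < m" "j < k"
  shows "(A * B) $$ (i, j) = (\<Sum>l<n. A $$ (i, l) * B $$ (l, j))"
  using assms by (simp add: scalar_prod_def atLeast0LessThan)

lemma eval_poly_mat_carrier [simp]:
  assumes "A \<in> carrier_mat n n" shows "eval_poly_mat f A \<in> carrier_mat n n"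
  using assms by (auto simp: eval_poly_mat_def)

lemma dim_eval_poly_mat [simp]:
  "dim_row (eval_poly_mat f A) = dim_row A" "dim_col (eval_poly_mat f A) = dim_row A"
  by (simp_all add: eval_poly_mat_def)

text \<open>
  Padding the sum up to any bound on the degree lets polynomials of different degrees be compared
  term by term.
\<close>
lemma eval_poly_mat_index:
  assumes "A \<in> carrier_mat n n" "degree f \<le> d" "i < n" "j < n"
  shows "eval_poly_mat f A $$ (i, j) = (\<Sum>k\<le>d. coeff f k * (A ^\<^sub>m k) $$ (i, j))"
proof -
  have "(\<Sum>k\<le>degree f. coeff f k * (A ^\<^sub>m k) $$ (i, j))
      = (\<Sum>k\<le>d. coeff f k * (A ^\<^sub>m k) $$ (i, j))"
    using assms(2) by (intro sum.mono_neutral_left) (auto simp: coeff_eq_0)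
  then show ?thesis using assms by (simp add: eval_poly_mat_def)
qed

lemma eval_poly_mat_0 [simp]:
  "A \<in> carrier_mat n n \<Longrightarrow> eval_poly_mat 0 A = 0\<^sub>m n n"
  by (intro eq_matI) (auto simp: eval_poly_mat_def)

text \<open>
  Horner's rule: it turns each of the later facts on \<open>f(A)\<close> into an induction over \<open>pCons\<close>.
\<close>
lemma eval_poly_mat_pCons:
  assumes A: "A \<in> carrier_mat n n"
  shows "eval_poly_mat (pCons a f) A = a \<cdot>\<^sub>m 1\<^sub>m n + A * eval_poly_mat f A"
proof (rule eq_matI)
  let ?F = "eval_poly_mat f A"
  have F: "?F \<in> carrier_mat n n" using A by simp
  fix i j assume "i < dim_row (a \<cdot>\<^sub>m 1\<^sub>m n + A * ?F)" "j < dim_col (a \<cdot>\<^sub>m 1\<^sub>m n + A * ?F)"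
  then have ij: "i < n" "j < n" using A F by auto
  have pow: "A ^\<^sub>m k \<in> carrier_mat n n" for k using A by simp
  have comm: "A ^\<^sub>m Suc k = A * A ^\<^sub>m k" for k
  proof (induction k)
    case (Suc k)
    have "A ^\<^sub>m Suc (Suc k) = A * A ^\<^sub>m k * A" using Suc.IH by simp
    also have "\<dots> = A * A ^\<^sub>m Suc k" using assoc_mult_mat[OF A pow A, of k] by simp
    finally show ?case .
  qed (use A in simp)
  have "(A * ?F) $$ (i, j) = (\<Sum>l<n. A $$ (i, l) * (\<Sum>k\<le>degree f. coeff f k * (A ^\<^sub>m k) $$ (l, j)))"
    unfolding mult_mat_index_sum[OF A F ij]
    using ij by (intro sum.cong) (simp_all add: eval_poly_mat_index[OF A order_refl])
  also have "\<dots> = (\<Sum>k\<le>degree f. coeff f k * (\<Sum>l<n. A $$ (i, l) * (A ^\<^sub>m k) $$ (l, j)))"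
    by (simp add: sum_distrib_left mult.left_commute) (rule sum.swap)
  also have "\<dots> = (\<Sum>k\<le>degree f. coeff f k * (A ^\<^sub>m Suc k) $$ (i, j))"
    unfolding comm mult_mat_index_sum[OF A pow ij] by (rule refl)
  finally have AF: "(A * ?F) $$ (i, j) = (\<Sum>k\<le>degree f. coeff f k * (A ^\<^sub>m Suc k) $$ (i, j))" .
  have "eval_poly_mat (pCons a f) A $$ (i, j)
      = (\<Sum>k\<le>Suc (degree f). coeff (pCons a f) k * (A ^\<^sub>m k) $$ (i, j))"
    using ij by (intro eval_poly_mat_index[OF A]) (auto simp: degree_pCons_le)
  also have "\<dots> = a * (1\<^sub>m n) $$ (i, j) + (A * ?F) $$ (i, j)"
    unfolding sum.atMost_Suc_shift AF using A by simp
  finally show "eval_poly_mat (pCons a f) A $$ (i, j) = (a \<cdot>\<^sub>m 1\<^sub>m n + A * ?F) $$ (i, j)"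
    using ij A F by (subst index_add_mat(1)) (auto simp del: index_mult_mat(1))
qed (use assms in \<open>auto simp: eval_poly_mat_def\<close>)

lemma eval_poly_mat_add:
  assumes A: "A \<in> carrier_mat n n"
  shows "eval_poly_mat (f + g) A = eval_poly_mat f A + eval_poly_mat g A"
proof (rule eq_matI)
  fix i j assume "i < dim_row (eval_poly_mat f A + eval_poly_mat g A)"
    "j < dim_col (eval_poly_mat f A + eval_poly_mat g A)"
  then have ij: "i < n" "j < n" using A by (auto simp: eval_poly_mat_def)
  let ?d = "max (degree f) (degree g)"
  show "eval_poly_mat (f + g) A $$ (i, j) = (eval_poly_mat f A + eval_poly_mat g A) $$ (i, j)"
    using ij A eval_poly_mat_index[OF A _ ij, of f ?d] eval_poly_mat_index[OF A _ ij, of g ?d]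
      eval_poly_mat_index[OF A degree_add_le_max ij, of f g] eval_poly_mat_carrier[OF A]
    by (simp add: sum.distrib distrib_right eval_poly_mat_def)
qed (use A in \<open>auto simp: eval_poly_mat_def\<close>)

lemma eval_poly_mat_smult:
  assumes A: "A \<in> carrier_mat n n"
  shows "eval_poly_mat (Polynomial.smult c f) A = c \<cdot>\<^sub>m eval_poly_mat f A"
proof (rule eq_matI)
  fix i j assume "i < dim_row (c \<cdot>\<^sub>m eval_poly_mat f A)" "j < dim_col (c \<cdot>\<^sub>m eval_poly_mat f A)"
  then have ij: "i < n" "j < n" using A by (auto simp: eval_poly_mat_def)
  show "eval_poly_mat (Polynomial.smult c f) A $$ (i, j) = (c \<cdot>\<^sub>m eval_poly_mat f A) $$ (i, j)"
    using ij A eval_poly_mat_index[OF A degree_smult_le ij, of c f]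
    by (simp add: eval_poly_mat_def sum_distrib_left mult.assoc)
qed (use A in \<open>auto simp: eval_poly_mat_def\<close>)

lemma smult_zero_mat_one: "(0 :: 'a :: semiring_1) \<cdot>\<^sub>m 1\<^sub>m n = 0\<^sub>m n n"
  by (intro eq_matI) auto

lemma eval_poly_mat_mult:
  assumes A: "A \<in> carrier_mat n n"
  shows "eval_poly_mat (f * g) A = eval_poly_mat f A * eval_poly_mat g A"
proof (induction f)
  case 0
  have "0\<^sub>m n n * eval_poly_mat g A = 0\<^sub>m n n" using eval_poly_mat_carrier[OF A] by (rule left_mult_zero_mat)
  then show ?case using A by simp
next
  case (pCons a f)
  let ?F = "eval_poly_mat f A" and ?G = "eval_poly_mat g A"
  have F: "?F \<in> carrier_mat n n" and G: "?G \<in> carrier_mat n n" using A by simp_all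
  have "eval_poly_mat (pCons a f * g) A = a \<cdot>\<^sub>m ?G + (0 \<cdot>\<^sub>m 1\<^sub>m n + A * (?F * ?G))"
    by (simp only: mult_pCons_left eval_poly_mat_add[OF A] eval_poly_mat_smult[OF A]
          eval_poly_mat_pCons[OF A] pCons.IH)
  also have "0 \<cdot>\<^sub>m 1\<^sub>m n + A * (?F * ?G) = A * (?F * ?G)"
    unfolding smult_zero_mat_one
    by (rule left_add_zero_mat) (intro mult_carrier_mat[OF A] mult_carrier_mat[OF F G])
  also have "\<dots> = A * ?F * ?G" by (rule assoc_mult_mat[OF A F G, symmetric])
  also have "a \<cdot>\<^sub>m ?G + A * ?F * ?G = (a \<cdot>\<^sub>m 1\<^sub>m n + A * ?F) * ?G"
    using mult_smult_assoc_mat[OF one_carrier_mat G, of a] left_mult_one_mat[OF G]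
    by (subst add_mult_distrib_mat[OF _ mult_carrier_mat[OF A F] G]) auto
  finally show ?case by (simp only: eval_poly_mat_pCons[OF A])
qed

lemma eval_poly_mat_1:
  "A \<in> carrier_mat n n \<Longrightarrow> eval_poly_mat 1 A = 1\<^sub>m n"
  by (intro eq_matI) (auto simp: eval_poly_mat_def)

lemma eval_poly_mat_commute:
  assumes A: "A \<in> carrier_mat n n" and D: "D \<in> carrier_mat n n" and AD: "A * D = D * A"
  shows "eval_poly_mat f A * D = D * eval_poly_mat f A"
proof (induction f)
  case 0
  show ?case using A D by simp
next
  case (pCons a f)
  let ?F = "eval_poly_mat f A"
  have F: "?F \<in> carrier_mat n n" using A by simp
  have AF: "A * ?F \<in> carrier_mat n n" by (rule mult_carrier_mat[OF A F])
  have "A * ?F * D = A * D * ?F"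
    unfolding assoc_mult_mat[OF A F D] assoc_mult_mat[OF A D F] pCons.IH by (rule refl)
  also have "\<dots> = D * (A * ?F)" unfolding AD by (rule assoc_mult_mat[OF D A F])
  finally have "A * ?F * D = D * (A * ?F)" .
  moreover have "(a \<cdot>\<^sub>m 1\<^sub>m n + A * ?F) * D = a \<cdot>\<^sub>m D + A * ?F * D"
    using mult_smult_assoc_mat[OF one_carrier_mat D, of a] left_mult_one_mat[OF D]
    by (subst add_mult_distrib_mat[OF _ AF D]) auto
  moreover have "D * (a \<cdot>\<^sub>m 1\<^sub>m n + A * ?F) = a \<cdot>\<^sub>m D + D * (A * ?F)"
    using mult_smult_distrib[OF D one_carrier_mat, of a] right_mult_one_mat[OF D]
    by (subst mult_add_distrib_mat[OF D _ AF]) auto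
  ultimately show ?case unfolding eval_poly_mat_pCons[OF A] by simp
qed

text \<open>
  The commutator with \<open>X\<close> is a derivation \<open>\<delta>\<close>. Since \<open>\<delta>(A) = D\<close> commutes with \<open>A\<close>, the chain rule
  \<open>\<delta>(f(A)) = f'(A) D\<close> holds exactly as it does in a commutative ring.
\<close>
lemma eval_poly_mat_commutator:
  assumes A: "A \<in> carrier_mat n n" and X: "X \<in> carrier_mat n n" and D: "D \<in> carrier_mat n n"
    and AX: "A * X = X * A + D" and AD: "A * D = D * A"
  shows "eval_poly_mat f A * X = X * eval_poly_mat f A + eval_poly_mat (pderiv f) A * D"
proof (induction f)
  case 0
  show ?case using A X D by simp
next
  case (pCons a f)
  let ?F = "eval_poly_mat f A" and ?F' = "eval_poly_mat (pderiv f) A"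
  have F: "?F \<in> carrier_mat n n" and F': "?F' \<in> carrier_mat n n" using A by simp_all
  note cl = A X D F F' mult_carrier_mat[OF X A] mult_carrier_mat[OF X F] mult_carrier_mat[OF A F]
    mult_carrier_mat[OF A F'] mult_carrier_mat[OF F' D] mult_carrier_mat[OF F D]
  have XAF: "X * (A * ?F) \<in> carrier_mat n n" and FD: "?F * D \<in> carrier_mat n n"
    and AFD: "A * ?F' * D \<in> carrier_mat n n" and aX: "a \<cdot>\<^sub>m X \<in> carrier_mat n n"
    and QR: "?F * D + A * ?F' * D \<in> carrier_mat n n"
    by (intro add_carrier_mat mult_carrier_mat[OF X] mult_carrier_mat[OF F D]
        mult_carrier_mat[OF A] mult_carrier_mat[OF mult_carrier_mat[OF A F'] D] F smult_carrier_mat X)+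
  have "A * ?F * X = A * (X * ?F + ?F' * D)"
    by (simp only: assoc_mult_mat[OF A F X] pCons.IH)
  also have "\<dots> = A * X * ?F + A * ?F' * D"
    by (simp only: mult_add_distrib_mat[OF A cl(7) cl(10)] assoc_mult_mat[OF A X F] assoc_mult_mat[OF A F' D])
  also have "A * X * ?F = X * (A * ?F) + ?F * D"
    by (simp only: AX add_mult_distrib_mat[OF cl(6) D F] assoc_mult_mat[OF X A F]
        eval_poly_mat_commute[OF A D AD])
  finally have main: "A * ?F * X = X * (A * ?F) + ?F * D + A * ?F' * D" .
  have F'': "eval_poly_mat (pderiv (pCons a f)) A * D = ?F * D + A * ?F' * D"
    unfolding pderiv_pCons eval_poly_mat_add[OF A] eval_poly_mat_pCons[OF A] smult_zero_mat_one
      left_add_zero_mat[OF cl(9)] by (rule add_mult_distrib_mat[OF F cl(9) D])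
  have "(a \<cdot>\<^sub>m 1\<^sub>m n + A * ?F) * X = a \<cdot>\<^sub>m X + A * ?F * X"
    using mult_smult_assoc_mat[OF one_carrier_mat X, of a] left_mult_one_mat[OF X]
    by (subst add_mult_distrib_mat[OF _ cl(8) X]) auto
  moreover have "X * (a \<cdot>\<^sub>m 1\<^sub>m n + A * ?F) = a \<cdot>\<^sub>m X + X * (A * ?F)"
    using mult_smult_distrib[OF X one_carrier_mat, of a] right_mult_one_mat[OF X]
    by (subst mult_add_distrib_mat[OF X _ cl(8)]) auto
  ultimately show ?case
    unfolding F'' eval_poly_mat_pCons[OF A] main
    by (simp only: assoc_add_mat[OF XAF FD AFD] assoc_add_mat[OF aX XAF QR])
qed

text \<open>
  Applied to \<open>f = p\<close>, the chain rule gives \<open>p'(A) D = 0\<close>. A Bezout identity \<open>u p + v p' = 1\<close> evaluated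
  at \<open>A\<close> shows that \<open>p'(A)\<close> is invertible, hence \<open>D = 0\<close>. In other words, if \<open>A\<close> is annihilated by a
  separable polynomial, then the kernel of the operator \<open>X \<mapsto> A X - X A\<close> meets its image only in \<open>0\<close>.
\<close>
lemma separable_commutator_zero:
  fixes p :: "'a :: field poly"
  assumes A: "A \<in> carrier_mat n n" and X: "X \<in> carrier_mat n n" and D: "D \<in> carrier_mat n n"
    and AX: "A * X = X * A + D" and AD: "A * D = D * A"
    and p: "eval_poly_mat p A = 0\<^sub>m n n" and sep: "separable p"
  shows "D = 0\<^sub>m n n"
proof -
  let ?E = "\<lambda>f. eval_poly_mat f A"
  have E: "?E f \<in> carrier_mat n n" for f using A by simp
  obtain u v where uv: "u * p + v * pderiv p = 1"
    using sep coprime_imp_bezout unfolding separable_def by blast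
  have pD: "?E (pderiv p) * D \<in> carrier_mat n n" by (rule mult_carrier_mat[OF E D])
  have "?E p * X = X * ?E p + ?E (pderiv p) * D"
    by (rule eval_poly_mat_commutator[OF A X D AX AD])
  then have z: "?E (pderiv p) * D = 0\<^sub>m n n"
    unfolding p left_mult_zero_mat[OF X] right_mult_zero_mat[OF X] left_add_zero_mat[OF pD] by (rule sym)
  have "1\<^sub>m n = ?E (u * p + v * pderiv p)"
    unfolding uv by (rule eval_poly_mat_1[OF A, symmetric])
  also have "\<dots> = ?E v * ?E (pderiv p)"
    unfolding eval_poly_mat_add[OF A] eval_poly_mat_mult[OF A] p right_mult_zero_mat[OF E]
    by (rule left_add_zero_mat[OF mult_carrier_mat[OF E E]])
  finally have "D = ?E v * ?E (pderiv p) * D" using left_mult_one_mat[OF D] by simp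
  also have "\<dots> = 0\<^sub>m n n"
    unfolding assoc_mult_mat[OF E E D] z by (rule right_mult_zero_mat[OF E])
  finally show ?thesis .
qed

section \<open>The companion matrix is a root of its polynomial\<close>

lemma companion_mat_carrier [simp]: "companion_mat p \<in> carrier_mat (degree p) (degree p)"
  by (simp add: companion_mat_def)

text \<open>
  Multiplication by the companion matrix shifts the rows down and subtracts \<open>coeff p i\<close> times the
  row that drops out at the bottom: multiplication by \<open>x\<close> modulo \<open>p\<close> in the basis \<open>1, x, x\<^sup>2, \<dots>\<close>.
\<close>
lemma companion_mat_mult_index:
  assumes B: "B \<in> carrier_mat (degree p) c" and i: "i < degree p" and j: "j < c"
  shows "(companion_mat p * B) $$ (i, j)
    = (if i = 0 then 0 else B $$ (i - 1, j)) - coeff p i * B $$ (degree p - 1, j)"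
proof -
  obtain t where t: "degree p = Suc t" using i by (cases "degree p") auto
  have "(companion_mat p * B) $$ (i, j) = (\<Sum>l<Suc t. companion_mat p $$ (i, l) * B $$ (l, j))"
    using mult_mat_index_sum[OF companion_mat_carrier B i j] t by simp
  also have "\<dots> = (\<Sum>l<t. (if i = Suc l then B $$ (l, j) else 0)) - coeff p i * B $$ (t, j)"
    using i t by (simp add: companion_mat_def) (intro sum.cong, auto)
  also have "(\<Sum>l<t. (if i = Suc l then B $$ (l, j) else 0)) = (if i = 0 then 0 else B $$ (i - 1, j))"
    using i t by (cases i) auto
  finally show ?thesis using t by simp
qed

lemma eval_poly_companion_pCons_index:
  assumes "i < degree p"
  shows "eval_poly_mat (pCons a f) (companion_mat p) $$ (i, 0)
    = (if i = 0 then a else eval_poly_mat f (companion_mat p) $$ (i - 1, 0))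
      - coeff p i * eval_poly_mat f (companion_mat p) $$ (degree p - 1, 0)"
proof -
  let ?C = "companion_mat p" and ?s = "degree p"
  let ?F = "eval_poly_mat f ?C"
  have F: "?F \<in> carrier_mat ?s ?s" by (rule eval_poly_mat_carrier[OF companion_mat_carrier])
  have CF: "?C * ?F \<in> carrier_mat ?s ?s" by (rule mult_carrier_mat[OF companion_mat_carrier F])
  have "eval_poly_mat (pCons a f) ?C $$ (i, 0) = (a \<cdot>\<^sub>m 1\<^sub>m ?s) $$ (i, 0) + (?C * ?F) $$ (i, 0)"
    unfolding eval_poly_mat_pCons[OF companion_mat_carrier]
    using CF assms by (intro index_add_mat(1)) auto
  also have "(?C * ?F) $$ (i, 0)
    = (if i = 0 then 0 else ?F $$ (i - 1, 0)) - coeff p i * ?F $$ (?s - 1, 0)"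
    using assms by (intro companion_mat_mult_index[OF F]) auto
  finally show ?thesis using assms by simp
qed

text \<open>
  The first basis vector represents \<open>1\<close>, so \<open>f(C)\<close> sends it to the coordinates of \<open>f\<close> as long as no
  reduction modulo \<open>p\<close> takes place.
\<close>
lemma eval_poly_companion_first_col:
  assumes "f = 0 \<or> degree f < degree p" "i < degree p"
  shows "eval_poly_mat f (companion_mat p) $$ (i, 0) = coeff f i"
  using assms
proof (induction f arbitrary: i)
  case 0
  then show ?case by (simp add: eval_poly_mat_0[OF companion_mat_carrier])
next
  case (pCons a f)
  let ?C = "companion_mat p"
  have f: "f = 0 \<or> Suc (degree f) < degree p" using pCons.prems by (auto split: if_splits)
  have IH: "eval_poly_mat f ?C $$ (k, 0) = coeff f k" if "k < degree p" for k
    using that f by (intro pCons.IH) auto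
  have "coeff f (degree p - 1) = 0" using f by (auto intro: coeff_eq_0)
  then show ?case using pCons.prems(2)
    by (cases i) (auto simp: eval_poly_companion_pCons_index IH)
qed

text \<open>
  The first basis vector \<open>e\<^sub>0\<close> is cyclic for \<open>C\<close>. One more application of \<open>C\<close> than in the previous lemma
  gives \<open>p(C) e\<^sub>0 = 0\<close>, and \<open>p(C)\<close> then kills every \<open>e\<^sub>j = C\<^sup>j e\<^sub>0\<close> because it commutes with \<open>C\<^sup>j\<close>.
\<close>
lemma eval_poly_mat_companion:
  fixes p :: "'a :: comm_ring_1 poly"
  assumes "lead_coeff p = 1" 
  shows "eval_poly_mat p (companion_mat p) = 0\<^sub>m (degree p) (degree p)"
proof (rule eq_matI)
  let ?C = "companion_mat p" and ?s = "degree p"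
  let ?E = "\<lambda>f. eval_poly_mat f ?C"
  have E: "?E f \<in> carrier_mat ?s ?s" for f by (rule eval_poly_mat_carrier[OF companion_mat_carrier])
  have col0: "?E p $$ (i, 0) = 0" if i: "i < ?s" for i
  proof -
    obtain a g where p: "p = pCons a g" by (cases p)
    have g: "g \<noteq> 0" "?s = Suc (degree g)" using i p by (auto split: if_splits)
    have "?E p $$ (i, 0) = (if i = 0 then a else ?E g $$ (i - 1, 0)) - coeff p i * ?E g $$ (?s - 1, 0)"
      using eval_poly_companion_pCons_index[OF i, of a g] p by simp
    also have "\<dots> = (if i = 0 then a else coeff g (i - 1)) - coeff p i * coeff g (degree g)"
      using i g by (simp add: eval_poly_companion_first_col)
    also have "coeff g (degree g) = 1" using assms g p by simp
    finally show ?thesis using p by (cases i) auto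
  qed
  \<comment> \<open>Column \<open>j\<close> of \<open>p(C)\<close> is column \<open>0\<close> of \<open>p(C) C\<^sup>j = C\<^sup>j p(C)\<close>.\<close>
  fix i j assume "i < dim_row (0\<^sub>m ?s ?s)" "j < dim_col (0\<^sub>m ?s ?s)"
  then have ij: "i < ?s" "j < ?s" by auto
  let ?M = "?E (Polynomial.monom 1 j)"
  have M: "?M $$ (k, 0) = (if k = j then 1 else 0)" if "k < ?s" for k
    using that ij by (subst eval_poly_companion_first_col) (auto simp: degree_monom_eq)
  have "(\<Sum>k<?s. ?E p $$ (i, k) * ?M $$ (k, 0)) = (\<Sum>k<?s. if k = j then ?E p $$ (i, k) else 0)"
    by (intro sum.cong) (auto simp: M)
  then have "?E p $$ (i, j) = (\<Sum>k<?s. ?E p $$ (i, k) * ?M $$ (k, 0))" using ij by simp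
  also have "\<dots> = (?E p * ?M) $$ (i, 0)"
    using ij by (intro mult_mat_index_sum[OF E E, symmetric]) auto
  also have "?E p * ?M = ?M * ?E p"
    unfolding eval_poly_mat_mult[OF companion_mat_carrier, symmetric] by (simp add: mult.commute)
  also have "(?M * ?E p) $$ (i, 0) = (\<Sum>k<?s. ?M $$ (i, k) * ?E p $$ (k, 0))"
    using ij by (intro mult_mat_index_sum[OF E E]) auto
  also have "\<dots> = 0" by (simp add: col0)
  finally show "?E p $$ (i, j) = 0\<^sub>m ?s ?s $$ (i, j)" using ij by simp
qed (auto simp: eval_poly_mat_def companion_mat_def)

section \<open>Grids of blocks linked by a commutator equation\<close>

text \<open>
  The hypothesis expresses the commutator of \<open>C\<close> and \<open>B k l\<close> as the difference between the right and
  the upper neighbour of \<open>B k l\<close>, where blocks outside the grid count as zero. Moving from the upper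
  right corner of the grid to the lower left one, both neighbours already commute with \<open>C\<close>; so does
  their difference, which therefore vanishes by \<open>separable_commutator_zero\<close>.
\<close>
lemma commuting_blocks:
  fixes p :: "'a :: field poly" and B :: "nat \<Rightarrow> nat \<Rightarrow> 'a mat"
  assumes C: "C \<in> carrier_mat s s" and p: "eval_poly_mat p C = 0\<^sub>m s s" and sep: "separable p"
    and B: "\<And>k l. B k l \<in> carrier_mat s s"
    and eq: "\<And>k l. k < a \<Longrightarrow> l < b \<Longrightarrow>
      C * B k l + (if k = 0 then 0\<^sub>m s s else B (k - 1) l) = B k l * C + (if Suc l = b then 0\<^sub>m s s else B k (Suc l))"
    and "k < a" "l < b"
  shows "C * B k l = B k l * C \<and>
    (if k = 0 then 0\<^sub>m s s else B (k - 1) l) = (if Suc l = b then 0\<^sub>m s s else B k (Suc l))"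
  using \<open>k < a\<close> \<open>l < b\<close>
proof (induction "k + (b - l)" arbitrary: k l rule: less_induct)
  case less
  let ?P = "if k = 0 then 0\<^sub>m s s else B (k - 1) l" and ?N = "if Suc l = b then 0\<^sub>m s s else B k (Suc l)"
  let ?D = "?N - ?P"
  have P: "?P \<in> carrier_mat s s" and N: "?N \<in> carrier_mat s s" using B by auto
  have D: "?D \<in> carrier_mat s s" using P by (rule minus_carrier_mat)
  \<comment> \<open>Both neighbours are one step closer to the upper right corner.\<close>
  have CP: "C * ?P = ?P * C"
  proof (cases "k = 0")
    case False
    then show ?thesis using less.hyps[of "k - 1" l] less.prems by simp
  qed (use C in simp)
  have CN: "C * ?N = ?N * C"
  proof (cases "Suc l = b")
    case False
    then show ?thesis using less.hyps[of k "Suc l"] less.prems by simp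
  qed (use C in simp)
  note cb = mult_carrier_mat[OF C B[of k l]] mult_carrier_mat[OF B[of k l] C]
  have "C * B k l = B k l * C + ?D"
  proof (rule eq_matI)
    fix i j assume "i < dim_row (B k l * C + ?D)" "j < dim_col (B k l * C + ?D)"
    then have ij: "i < s" "j < s" using D by auto
    have "(C * B k l + ?P) $$ (i, j) = (B k l * C + ?N) $$ (i, j)"
      by (simp only: eq[OF less.prems])
    then have "(C * B k l) $$ (i, j) + ?P $$ (i, j) = (B k l * C) $$ (i, j) + ?N $$ (i, j)"
      using ij P N by (simp only: index_add_mat(1) carrier_matD)
    moreover have "(B k l * C + ?D) $$ (i, j) = (B k l * C) $$ (i, j) + (?N $$ (i, j) - ?P $$ (i, j))"
      using ij P D by (simp only: index_add_mat(1) index_minus_mat(1) carrier_matD)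
    ultimately show "(C * B k l) $$ (i, j) = (B k l * C + ?D) $$ (i, j)"
      by (simp only:) (simp add: algebra_simps)
  qed (use cb D in \<open>simp_all only: carrier_matD index_add_mat\<close>)
  moreover have "C * ?D = ?D * C"
    by (simp only: mult_minus_distrib_mat[OF C N P] minus_mult_distrib_mat[OF N P C] CP CN)
  ultimately have D0: "?D = 0\<^sub>m s s"
    by (intro separable_commutator_zero[OF C B D _ _ p sep])
  have "C * B k l = B k l * C"
    using \<open>C * B k l = B k l * C + ?D\<close> unfolding D0 right_add_zero_mat[OF cb(2)] .
  moreover have "?P = ?N"
  proof (rule eq_matI)
    fix i j assume "i < dim_row ?N" "j < dim_col ?N"
    then have ij: "i < s" "j < s" using N by (simp_all only: carrier_matD)
    have "?N $$ (i, j) - ?P $$ (i, j) = 0"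
      using arg_cong[OF D0, of "\<lambda>M. M $$ (i, j)"] ij P by (simp only: index_minus_mat(1) carrier_matD index_zero_mat)
    then show "?P $$ (i, j) = ?N $$ (i, j)" by (simp only: right_minus_eq)
  qed (use P N in \<open>simp_all only: carrier_matD\<close>)
  ultimately show ?case by (rule conjI)
qed

text \<open>
  A diagonal that starts in the top row to the right of the corner starts with \<open>z\<close>, and one that ends
  in the last column above the bottom row ends with \<open>z\<close>; \<open>k + b < a + l\<close> says that the diagonal through
  \<open>(k, l)\<close> leaves the grid through its right edge before it reaches the bottom row.
\<close>
lemma toeplitz_grid:
  fixes B :: "nat \<Rightarrow> nat \<Rightarrow> 'b"
  assumes shift: "\<And>k l. Suc k < a \<Longrightarrow> Suc l < b \<Longrightarrow> B (Suc k) (Suc l) = B k l"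
    and top: "\<And>l. Suc l < b \<Longrightarrow> 0 < a \<Longrightarrow> B 0 (Suc l) = z"
    and last: "\<And>k. Suc k < a \<Longrightarrow> 0 < b \<Longrightarrow> B k (b - 1) = z"
    and kl: "k < a" "l < b"
  shows "k' < a \<Longrightarrow> l' < b \<Longrightarrow> int k - int l = int k' - int l' \<Longrightarrow> B k l = B k' l'"
    and "k < l \<Longrightarrow> B k l = z"
    and "k + b < a + l \<Longrightarrow> B k l = z"
proof -
  have shifts: "B (k + n) (l + n) = B k l" if "k + n < a" "l + n < b" for k l n
    using that by (induction n) (simp_all add: shift)
  show "B k l = B k' l'" if "k' < a" "l' < b" and d: "int k - int l = int k' - int l'"
  proof (cases "k \<le> k'")
    case True
    then have "k' = k + (k' - k)" "l' = l + (k' - k)" using d by auto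
    then show ?thesis using shifts[of k "k' - k" l] that by metis
  next
    case False
    then have "k = k' + (k - k')" "l = l' + (k - k')" using d by auto
    then show ?thesis using shifts[of k' "k - k'" l'] kl by metis
  qed
  show "B k l = z" if "k < l"
    using shifts[of 0 k "l - k"] top[of "l - k - 1"] kl that by (simp add: Suc_diff_Suc)
  show "B k l = z" if "k + b < a + l"
    using shifts[of k "b - 1 - l" l] last[of "k + (b - 1 - l)"] kl that by simp
qed

section \<open>Blocks of partitioned and of block diagonal matrices\<close>

lemma pick_atLeastLessThan:
  assumes "u < h" shows "pick {c..<c + h} u = c + u"
proof -
  have "{x \<in> {c..<c + h}. x < c + u} = {c..<c + u}" using assms by auto
  then have "card {x \<in> {c..<c + h}. x < c + u} = u" by simp
  then show ?thesis using pick_card_in_set[of "c + u" "{c..<c + h}"] assms by simp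
qed

lemma submatrix_atLeastLessThan:
  assumes "c + h \<le> dim_row X" "q + w \<le> dim_col X"
  shows "submatrix X {c..<c + h} {q..<q + w} = mat h w (\<lambda>(u, v). X $$ (c + u, q + v))"
proof -
  have "{i. i < dim_row X \<and> i \<in> {c..<c + h}} = {c..<c + h}"
    "{i. i < dim_col X \<and> i \<in> {q..<q + w}} = {q..<q + w}" using assms by auto
  then show ?thesis by (intro eq_matI) (auto simp: submatrix_def pick_atLeastLessThan)
qed

lemma sum_list_take_le: "sum_list (take i xs) \<le> sum_list (xs :: nat list)"
  by (metis append_take_drop_id le_add1 sum_list_append)

lemma mat_block_eq:
  assumes "X \<in> carrier_mat (sum_list \<rho>) (sum_list \<kappa>)" "i < length \<rho>" "j < length \<kappa>"
  shows "mat_block \<rho> \<kappa> X i j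
    = mat (\<rho> ! i) (\<kappa> ! j) (\<lambda>(u, v). X $$ (sum_list (take i \<rho>) + u, sum_list (take j \<kappa>) + v))"
proof -
  have S: "sum_list (take (Suc i) \<rho>) = sum_list (take i \<rho>) + \<rho> ! i"
    "sum_list (take (Suc j) \<kappa>) = sum_list (take j \<kappa>) + \<kappa> ! j"
    using assms by (simp_all add: take_Suc_conv_app_nth)
  then have "sum_list (take i \<rho>) + \<rho> ! i \<le> dim_row X" "sum_list (take j \<kappa>) + \<kappa> ! j \<le> dim_col X"
    using sum_list_take_le[of "Suc i" \<rho>] sum_list_take_le[of "Suc j" \<kappa>] assms by auto
  then show ?thesis unfolding mat_block_def S by (rule submatrix_atLeastLessThan)
qed

lemma diag_block_mat_row:
  fixes As :: "'a :: zero mat list"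
  assumes "\<forall>A\<in>set As. square_mat A" "i < length As" "u < dim_row (As ! i)" "w < sum_list (map dim_row As)"
  shows "diag_block_mat As $$ (sum_list (take i (map dim_row As)) + u, w)
    = (if sum_list (take i (map dim_row As)) \<le> w \<and> w < sum_list (take i (map dim_row As)) + dim_row (As ! i)
       then As ! i $$ (u, w - sum_list (take i (map dim_row As))) else 0)"
  using assms
proof (induction As arbitrary: i w)
  case (Cons A As)
  have dims: "map dim_col As = map dim_row As" using Cons.prems(1) by auto
  have B: "dim_row (diag_block_mat As) = sum_list (map dim_row As)"
    "dim_col (diag_block_mat As) = sum_list (map dim_row As)" "dim_col A = dim_row A"
    using Cons.prems(1) by (simp_all add: dim_diag_block_mat dims)
  show ?case
  proof (cases i)
    case 0
    then show ?thesis using Cons.prems B by (auto simp: Let_def)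
  next
    case (Suc k)
    let ?o = "sum_list (take k (map dim_row As))"
    have k: "k < length As" "u < dim_row (As ! k)" using Cons.prems Suc by auto
    have "?o + dim_row (As ! k) \<le> sum_list (map dim_row As)"
      using sum_list_take_le[of "Suc k" "map dim_row As"] k by (simp add: take_Suc_conv_app_nth)
    then have r: "?o + u < sum_list (map dim_row As)" using k by simp
    show ?thesis
    proof (cases "w < dim_row A")
      case True
      then show ?thesis using Suc B r by (auto simp: Let_def)
    next
      case False
      then have w: "w - dim_row A < sum_list (map dim_row As)" using Cons.prems by auto
      have "diag_block_mat As $$ (?o + u, w - dim_row A)
        = (if ?o \<le> w - dim_row A \<and> w - dim_row A < ?o + dim_row (As ! k)
       then As ! k $$ (u, w - dim_row A - ?o) else 0)"
        using Cons.prems(1) k w by (intro Cons.IH) auto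
      then show ?thesis using False Suc B r w by (auto simp: Let_def diff_diff_left)
    qed
  qed
qed simp

lemma transpose_diag_block_mat:
  "transpose_mat (diag_block_mat As) = diag_block_mat (map transpose_mat As)"
proof (induction As)
  case (Cons A As)
  let ?D = "diag_block_mat As"
  have "transpose_mat (four_block_mat A (0\<^sub>m (dim_row A) (dim_col ?D)) (0\<^sub>m (dim_row ?D) (dim_col A)) ?D)
    = four_block_mat (transpose_mat A) (transpose_mat (0\<^sub>m (dim_row ?D) (dim_col A)))
        (transpose_mat (0\<^sub>m (dim_row A) (dim_col ?D))) (transpose_mat ?D)"
    by (rule transpose_four_block_mat) auto
  then show ?case by (simp add: Let_def flip: Cons.IH)
qed (intro eq_matI, auto)

lemma diag_block_mat_col:
  fixes As :: "'a :: zero mat list"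
  assumes sq: "\<forall>A\<in>set As. square_mat A" and i: "i < length As"
    and u: "u < dim_row (As ! i)" and w: "w < sum_list (map dim_row As)"
  shows "diag_block_mat As $$ (w, sum_list (take i (map dim_row As)) + u)
    = (if sum_list (take i (map dim_row As)) \<le> w \<and> w < sum_list (take i (map dim_row As)) + dim_row (As ! i)
       then As ! i $$ (w - sum_list (take i (map dim_row As)), u) else 0)"
proof -
  let ?c = "sum_list (take i (map dim_row As))" and ?n = "dim_row (As ! i)"
  have dims: "map dim_col As = map dim_row As" using sq by auto
  have ni: "dim_col (As ! i) = ?n" using sq i by auto
  have dimsT: "map dim_row (map transpose_mat As) = map dim_row As" using dims by simp
  have sqT: "\<forall>A\<in>set (map transpose_mat As). square_mat A" using sq by simp
  have "?c + ?n \<le> sum_list (map dim_row As)"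
    using sum_list_take_le[of "Suc i" "map dim_row As"] i by (simp add: take_Suc_conv_app_nth)
  then have cu: "?c + u < sum_list (map dim_row As)" using u by simp
  have "diag_block_mat As $$ (w, ?c + u) = transpose_mat (diag_block_mat As) $$ (?c + u, w)"
    using w cu by (simp add: dim_diag_block_mat dims)
  also have "\<dots> = (if ?c \<le> w \<and> w < ?c + ?n then transpose_mat (As ! i) $$ (u, w - ?c) else 0)"
    using diag_block_mat_row[OF sqT, of i u w, unfolded dimsT] i u w
    by (simp only: transpose_diag_block_mat length_map nth_map index_transpose_mat ni)
  also have "\<dots> = (if ?c \<le> w \<and> w < ?c + ?n then As ! i $$ (w - ?c, u) else 0)"
    using u ni by auto
  finally show ?thesis .
qed

lemma sum_lessThan_window:
  fixes f :: "nat \<Rightarrow> 'a :: comm_monoid_add"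
  assumes "c + h \<le> n"
  shows "(\<Sum>w<n. if c \<le> w \<and> w < c + h then f w else 0) = (\<Sum>w<h. f (c + w))"
proof -
  have "(\<Sum>w<n. if c \<le> w \<and> w < c + h then f w else 0) = (\<Sum>w\<in>{c..<c + h}. f w)"
    using assms by (intro sum.mono_neutral_cong_right) auto
  also have "\<dots> = (\<Sum>w<h. f (c + w))"
    using sum.shift_bounds_nat_ivl[of f 0 c h] by (simp add: add.commute atLeast0LessThan)
  finally show ?thesis .
qed

text \<open>
  Restricting \<open>G X = X G\<close> to one block of the partition: in the rows of the block \<open>i\<close> only the block
  \<open>As ! i\<close> of \<open>G\<close> is nonzero, and in the columns of the block \<open>j\<close> only \<open>As ! j\<close>.
\<close>
lemma diag_block_mat_centralizer_block:
  fixes As :: "'a :: comm_ring_1 mat list"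
  defines "ns \<equiv> map dim_row As"
  assumes sq: "\<forall>A\<in>set As. square_mat A" and X: "X \<in> centralizer_mat (diag_block_mat As)"
    and i: "i < length As" and j: "j < length As"
  shows "As ! i * mat_block ns ns X i j = mat_block ns ns X i j * As ! j"
proof -
  let ?G = "diag_block_mat As" and ?n = "sum_list ns"
  let ?oi = "sum_list (take i ns)" and ?oj = "sum_list (take j ns)"
  let ?ni = "dim_row (As ! i)" and ?nj = "dim_row (As ! j)"
  have dims: "map dim_col As = map dim_row As" using sq by auto
  have G: "?G \<in> carrier_mat ?n ?n" unfolding ns_def by (auto simp: dim_diag_block_mat dims)
  have XC: "X \<in> carrier_mat ?n ?n" and comm: "?G * X = X * ?G"
    using X G by (auto simp: centralizer_mat_def)
  have Ai: "As ! i \<in> carrier_mat ?ni ?ni" and Aj: "As ! j \<in> carrier_mat ?nj ?nj"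
    using sq i j nth_mem by (auto intro!: carrier_matI)
  let ?B = "mat ?ni ?nj (\<lambda>(u, v). X $$ (?oi + u, ?oj + v))"
  have B: "mat_block ns ns X i j = ?B"
    using mat_block_eq[OF XC, of i j] i j by (simp add: ns_def)
  have BC: "?B \<in> carrier_mat ?ni ?nj" by simp
  have le: "?oi + ?ni \<le> ?n" "?oj + ?nj \<le> ?n"
    using sum_list_take_le[of "Suc i" ns] sum_list_take_le[of "Suc j" ns] i j
    by (simp_all add: take_Suc_conv_app_nth ns_def)
  have "As ! i * ?B = ?B * As ! j"
  proof (rule eq_matI)
    fix u v assume "u < dim_row (?B * As ! j)" "v < dim_col (?B * As ! j)"
    then have uv: "u < ?ni" "v < ?nj"
      by (simp_all only: index_mult_mat dim_row_mat dim_col_mat carrier_matD(2)[OF Aj])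
    then have uv': "?oi + u < ?n" "?oj + v < ?n" using le by auto
    have "(As ! i * ?B) $$ (u, v) = (\<Sum>w<?ni. As ! i $$ (u, w) * X $$ (?oi + w, ?oj + v))"
      unfolding mult_mat_index_sum[OF Ai BC uv] using uv by simp
    also have "\<dots> = (\<Sum>w<?n. if ?oi \<le> w \<and> w < ?oi + ?ni then As ! i $$ (u, w - ?oi) * X $$ (w, ?oj + v) else 0)"
      unfolding sum_lessThan_window[OF le(1)] by simp
    also have "\<dots> = (\<Sum>w<?n. ?G $$ (?oi + u, w) * X $$ (w, ?oj + v))"
      using diag_block_mat_row[OF sq i uv(1)] unfolding ns_def by (intro sum.cong) auto
    also have "\<dots> = (X * ?G) $$ (?oi + u, ?oj + v)"
      unfolding comm[symmetric] by (rule mult_mat_index_sum[OF G XC uv', symmetric])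
    also have "\<dots> = (\<Sum>w<?n. X $$ (?oi + u, w) * ?G $$ (w, ?oj + v))"
      by (rule mult_mat_index_sum[OF XC G uv'])
    also have "\<dots> = (\<Sum>w<?n. if ?oj \<le> w \<and> w < ?oj + ?nj then X $$ (?oi + u, w) * As ! j $$ (w - ?oj, v) else 0)"
      using diag_block_mat_col[OF sq j uv(2)] unfolding ns_def by (intro sum.cong) auto
    also have "\<dots> = (\<Sum>w<?nj. X $$ (?oi + u, ?oj + w) * As ! j $$ (w, v))"
      unfolding sum_lessThan_window[OF le(2)] by simp
    also have "\<dots> = (?B * As ! j) $$ (u, v)"
      unfolding mult_mat_index_sum[OF BC Aj uv] using uv by simp
    finally show "(As ! i * ?B) $$ (u, v) = (?B * As ! j) $$ (u, v)" .
  qed (simp_all only: index_mult_mat dim_row_mat dim_col_mat carrier_matD(2)[OF Ai] carrier_matD(2)[OF Aj])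
  then show ?thesis unfolding B .
qed

section \<open>Matrices intertwining two generalized Jordan blocks\<close>

definition square_block :: "nat \<Rightarrow> 'a mat \<Rightarrow> nat \<Rightarrow> nat \<Rightarrow> 'a mat" where
  "square_block s T k l = mat s s (\<lambda>(u, v). T $$ (s * k + u, s * l + v))"

lemma square_block_carrier: "square_block s T k l \<in> carrier_mat s s"
  by (simp add: square_block_def)

lemma block_index_less: "k < a \<Longrightarrow> u < s \<Longrightarrow> s * k + u < s * (a :: nat)"
  using mult_le_mono2[of "Suc k" a s] by simp

lemma mat_block_replicate:
  assumes T: "T \<in> carrier_mat (s * a) (s * b)" and "k < a" "l < b"
  shows "mat_block (replicate a s) (replicate b s) T k l = square_block s T k l"
proof -
  have "T \<in> carrier_mat (sum_list (replicate a s)) (sum_list (replicate b s))"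
    using T by (simp add: sum_list_replicate mult.commute)
  then show ?thesis using assms
    by (simp add: mat_block_eq square_block_def sum_list_replicate mult.commute)
qed

lemma sum_lessThan_blocks:
  fixes f :: "nat \<Rightarrow> 'a :: comm_monoid_add"
  shows "(\<Sum>w<s * a. f w) = (\<Sum>k<a. \<Sum>u<s. f (s * k + u))"
proof (induction a)
  case (Suc a)
  have "{..<s * Suc a} = {..<s * a} \<union> {s * a..<s * a + s}" by auto
  then have "(\<Sum>w<s * Suc a. f w) = (\<Sum>w<s * a. f w) + (\<Sum>w\<in>{s * a..<s * a + s}. f w)"
    by (simp add: sum.union_disjoint ivl_disj_int)
  also have "(\<Sum>w\<in>{s * a..<s * a + s}. f w) = (\<Sum>u<s. f (s * a + u))"
    using sum.shift_bounds_nat_ivl[of f 0 "s * a" s] by (simp add: add.commute atLeast0LessThan)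
  finally show ?case by (simp add: Suc.IH)
qed simp

lemma gen_jordan_block_carrier: "gen_jordan_block p a \<in> carrier_mat (degree p * a) (degree p * a)"
  by (simp add: gen_jordan_block_def Let_def)

lemma gen_jordan_block_index:
  assumes "k < a" "l < a" "u < degree p" "v < degree p"
  shows "gen_jordan_block p a $$ (degree p * k + u, degree p * l + v)
    = (if k = l then companion_mat p $$ (u, v) else if k = Suc l \<and> u = v then 1 else 0)"
proof -
  have "(degree p * k + u) div degree p = k" "(degree p * k + u) mod degree p = u"
    "(degree p * l + v) div degree p = l" "(degree p * l + v) mod degree p = v"
    using assms by simp_all
  then show ?thesis
    using assms block_index_less[of k a u "degree p"] block_index_less[of l a v "degree p"]
    by (simp add: gen_jordan_block_def Let_def del: mult_Suc_right)
qed

lemma gen_jordan_block_leading: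
  assumes "a \<le> b" "i < degree p * a" "j < degree p * a"
  shows "gen_jordan_block p b $$ (i, j) = gen_jordan_block p a $$ (i, j)"
proof -
  have "i < degree p * b" "j < degree p * b"
    using assms(2,3) mult_le_mono2[OF assms(1)] less_le_trans by blast+
  then show ?thesis using assms(2,3) by (simp add: gen_jordan_block_def Let_def)
qed

lemma gen_jordan_block_trailing:
  assumes "i < degree p * b" "j < degree p * b"
  shows "gen_jordan_block p (c + b) $$ (degree p * c + i, degree p * c + j) = gen_jordan_block p b $$ (i, j)"
proof -
  have "degree p > 0" using assms(1) by (cases "degree p") auto
  then have "(degree p * c + n) div degree p = c + n div degree p" for n by simp
  then show ?thesis using assms by (simp add: gen_jordan_block_def Let_def distrib_left)
qed

text \<open>
  The block \<open>(k, l)\<close> of the intertwining equation. Left multiplication by the subdiagonal identity blocks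
  moves block rows down, right multiplication moves block columns to the left; this is what produces
  the two neighbours of the block \<open>(k, l)\<close>.
\<close>
lemma gen_jordan_intertwine_blocks:
  fixes p :: "'a :: comm_ring_1 poly"
  defines "s \<equiv> degree p"
  assumes T: "T \<in> carrier_mat (s * a) (s * b)"
    and JT: "gen_jordan_block p a * T = T * gen_jordan_block p b"
    and k: "k < a" and l: "l < b"
  shows "companion_mat p * square_block s T k l
      + (if k = 0 then 0\<^sub>m s s else square_block s T (k - 1) l)
    = square_block s T k l * companion_mat p
      + (if Suc l = b then 0\<^sub>m s s else square_block s T k (Suc l))"
    (is "?C * ?B k l + ?P = _ + ?N")
proof (rule eq_matI)
  let ?Ja = "gen_jordan_block p a" and ?Jb = "gen_jordan_block p b"
  have Ja: "?Ja \<in> carrier_mat (s * a) (s * a)" and Jb: "?Jb \<in> carrier_mat (s * b) (s * b)"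
    and C: "?C \<in> carrier_mat s s" unfolding s_def by (rule gen_jordan_block_carrier companion_mat_carrier)+
  note B = square_block_carrier[of s T]
  have P: "?P \<in> carrier_mat s s" and N: "?N \<in> carrier_mat s s" using B by auto
  fix u v assume "u < dim_row (?B k l * ?C + ?N)" "v < dim_col (?B k l * ?C + ?N)"
  then have u: "u < s" and v: "v < s" using N by auto
  have x: "s * k + u < s * a" and y: "s * l + v < s * b" using k l u v by (auto intro: block_index_less)
  have ite: "(if Q then 1 else 0) * t = (if Q then t else 0)" "t * (if Q then 1 else 0) = (if Q then t else 0)"
    for Q and t :: 'a by simp_all
  have "(?Ja * T) $$ (s * k + u, s * l + v)
    = (\<Sum>k'<a. \<Sum>w<s. ?Ja $$ (s * k + u, s * k' + w) * T $$ (s * k' + w, s * l + v))"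
    unfolding mult_mat_index_sum[OF Ja T x y] sum_lessThan_blocks ..
  also have "\<dots> = (\<Sum>k'<a. (if k' = k then \<Sum>w<s. ?C $$ (u, w) * T $$ (s * k' + w, s * l + v) else 0)
      + (if Suc k' = k then T $$ (s * k' + u, s * l + v) else 0))"
  proof (rule sum.cong[OF refl])
    fix k' assume "k' \<in> {..<a}"
    then have "(\<Sum>w<s. ?Ja $$ (s * k + u, s * k' + w) * T $$ (s * k' + w, s * l + v))
      = (\<Sum>w<s. (if k = k' then ?C $$ (u, w) else if k = Suc k' \<and> u = w then 1 else 0) * T $$ (s * k' + w, s * l + v))"
      using k u by (intro sum.cong refl) (simp add: s_def gen_jordan_block_index)
    also have "\<dots> = (if k' = k then \<Sum>w<s. ?C $$ (u, w) * T $$ (s * k' + w, s * l + v) else 0)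
      + (if Suc k' = k then T $$ (s * k' + u, s * l + v) else 0)"
      using u by (cases "k' = k"; cases "Suc k' = k") (simp_all add: ite)
    finally show "(\<Sum>w<s. ?Ja $$ (s * k + u, s * k' + w) * T $$ (s * k' + w, s * l + v))
      = (if k' = k then \<Sum>w<s. ?C $$ (u, w) * T $$ (s * k' + w, s * l + v) else 0)
      + (if Suc k' = k then T $$ (s * k' + u, s * l + v) else 0)" .
  qed
  also have "\<dots> = (\<Sum>w<s. ?C $$ (u, w) * ?B k l $$ (w, v)) + ?P $$ (u, v)"
  proof -
    have "(\<Sum>k'<a. if Suc k' = k then T $$ (s * k' + u, s * l + v) else 0) = ?P $$ (u, v)"
      using k u v by (cases k) (auto simp: square_block_def)
    then show ?thesis using k v by (simp add: sum.distrib square_block_def)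
  qed
  also have "\<dots> = (?C * ?B k l + ?P) $$ (u, v)"
    using mult_mat_index_sum[OF C B u v, of k l] P u v by (simp only: index_add_mat(1) carrier_matD)
  finally have L: "(?Ja * T) $$ (s * k + u, s * l + v) = (?C * ?B k l + ?P) $$ (u, v)" .
  have "(T * ?Jb) $$ (s * k + u, s * l + v)
    = (\<Sum>l'<b. \<Sum>w<s. T $$ (s * k + u, s * l' + w) * ?Jb $$ (s * l' + w, s * l + v))"
    unfolding mult_mat_index_sum[OF T Jb x y] sum_lessThan_blocks ..
  also have "\<dots> = (\<Sum>l'<b. (if l' = l then \<Sum>w<s. T $$ (s * k + u, s * l' + w) * ?C $$ (w, v) else 0)
      + (if l' = Suc l then T $$ (s * k + u, s * l' + v) else 0))"
  proof (rule sum.cong[OF refl])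
    fix l' assume "l' \<in> {..<b}"
    then have "(\<Sum>w<s. T $$ (s * k + u, s * l' + w) * ?Jb $$ (s * l' + w, s * l + v))
      = (\<Sum>w<s. T $$ (s * k + u, s * l' + w) * (if l' = l then ?C $$ (w, v) else if l' = Suc l \<and> w = v then 1 else 0))"
      using l v by (intro sum.cong refl) (simp add: s_def gen_jordan_block_index)
    also have "\<dots> = (if l' = l then \<Sum>w<s. T $$ (s * k + u, s * l' + w) * ?C $$ (w, v) else 0)
      + (if l' = Suc l then T $$ (s * k + u, s * l' + v) else 0)"
      using v by (cases "l' = l"; cases "l' = Suc l") (simp_all add: ite)
    finally show "(\<Sum>w<s. T $$ (s * k + u, s * l' + w) * ?Jb $$ (s * l' + w, s * l + v))
      = (if l' = l then \<Sum>w<s. T $$ (s * k + u, s * l' + w) * ?C $$ (w, v) else 0)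
      + (if l' = Suc l then T $$ (s * k + u, s * l' + v) else 0)" .
  qed
  also have "\<dots> = (\<Sum>w<s. ?B k l $$ (u, w) * ?C $$ (w, v)) + ?N $$ (u, v)"
  proof -
    have "(\<Sum>l'<b. if l' = Suc l then T $$ (s * k + u, s * l' + v) else 0) = ?N $$ (u, v)"
      using l u v by (auto simp: square_block_def)
    then show ?thesis using l u by (simp add: sum.distrib square_block_def)
  qed
  also have "\<dots> = (?B k l * ?C + ?N) $$ (u, v)"
    using mult_mat_index_sum[OF B C u v, of k l] N u v by (simp only: index_add_mat(1) carrier_matD)
  finally show "(?C * ?B k l + ?P) $$ (u, v) = (?B k l * ?C + ?N) $$ (u, v)"
    unfolding L[symmetric] JT .
qed (auto simp: square_block_def s_def companion_mat_def)

text \<open>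
  The two vanishing statements are the two ways in which a block diagonal can meet the border of the
  array. For \<open>a \<le> b\<close> the first one is the stronger, and it makes the last \<open>b - a\<close> block columns zero;
  for \<open>a \<ge> b\<close> the second one is, and it makes the first \<open>a - b\<close> block rows zero.
\<close>
lemma gen_jordan_intertwine:
  fixes p :: "'a :: field poly"
  defines "s \<equiv> degree p"
  assumes p: "lead_coeff p = 1" "separable p"
    and T: "T \<in> carrier_mat (s * a) (s * b)"
    and JT: "gen_jordan_block p a * T = T * gen_jordan_block p b"
  shows "block_lower_toeplitz s a b T"
    and "x < s * a \<Longrightarrow> y < s * b \<Longrightarrow> x div s < y div s \<Longrightarrow> T $$ (x, y) = 0"
    and "x < s * a \<Longrightarrow> y < s * b \<Longrightarrow> x div s + b < a + y div s \<Longrightarrow> T $$ (x, y) = 0"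
proof -
  let ?B = "square_block s T"
  have C: "companion_mat p \<in> carrier_mat s s" and pC: "eval_poly_mat p (companion_mat p) = 0\<^sub>m s s"
    unfolding s_def by (rule companion_mat_carrier eval_poly_mat_companion[OF p(1)])+
  have blocks: "(if k = 0 then 0\<^sub>m s s else ?B (k - 1) l) = (if Suc l = b then 0\<^sub>m s s else ?B k (Suc l))"
    if "k < a" "l < b" for k l
    using commuting_blocks[OF C pC p(2) square_block_carrier
        gen_jordan_intertwine_blocks[OF T[unfolded s_def] JT, folded s_def] that] by blast
  have shift: "?B (Suc k) (Suc l) = ?B k l" if "Suc k < a" "Suc l < b" for k l
    using blocks[of "Suc k" l] that by simp
  have top: "?B 0 (Suc l) = 0\<^sub>m s s" if "Suc l < b" "0 < a" for l
    using blocks[of 0 l] that by simp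
  have last: "?B k (b - 1) = 0\<^sub>m s s" if "Suc k < a" "0 < b" for k
    using blocks[of "Suc k" "b - 1"] that by simp
  have grid:
    "k < a \<Longrightarrow> l < b \<Longrightarrow> k' < a \<Longrightarrow> l' < b \<Longrightarrow> int k - int l = int k' - int l' \<Longrightarrow> ?B k l = ?B k' l'"
    "k < a \<Longrightarrow> l < b \<Longrightarrow> k < l \<Longrightarrow> ?B k l = 0\<^sub>m s s"
    "k < a \<Longrightarrow> l < b \<Longrightarrow> k + b < a + l \<Longrightarrow> ?B k l = 0\<^sub>m s s" for k l k' l'
    by (rule toeplitz_grid[where a = a and b = b and z = "0\<^sub>m s s"],
        (erule (1) shift top last | assumption)+)+
  show "block_lower_toeplitz s a b T"
    unfolding block_lower_toeplitz_def Let_def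
  proof (intro conjI allI impI)
    show "T \<in> carrier_mat (s * a) (s * b)" by (rule T)
  next
    fix k l k' l' assume kl: "k < a" "l < b" "k' < a" "l' < b" "int k - int l = int k' - int l'"
    show "mat_block (replicate a s) (replicate b s) T k l = mat_block (replicate a s) (replicate b s) T k' l'"
      unfolding mat_block_replicate[OF T kl(1,2)] mat_block_replicate[OF T kl(3,4)] by (rule grid(1)[OF kl])
  next
    fix k l assume kl: "k < a" "l < b" "k < l"
    show "mat_block (replicate a s) (replicate b s) T k l = 0\<^sub>m s s"
      unfolding mat_block_replicate[OF T kl(1,2)] by (rule grid(2)[OF kl])
  qed
  have entry: "T $$ (x, y) = 0"
    if "x < s * a" "y < s * b" "?B (x div s) (y div s) = 0\<^sub>m s s" for x y
  proof -
    have "s > 0" using that(1) by (cases s) auto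
    then have "T $$ (x, y) = ?B (x div s) (y div s) $$ (x mod s, y mod s)" by (simp add: square_block_def)
    then show ?thesis using that(3) \<open>s > 0\<close> by simp
  qed
  have div: "x div s < a" if "x < s * a" for x a using that by (simp add: less_mult_imp_div_less mult.commute)
  show "T $$ (x, y) = 0" if "x < s * a" "y < s * b" "x div s < y div s"
    using that by (intro entry grid(2)[OF div div])
  show "T $$ (x, y) = 0" if "x < s * a" "y < s * b" "x div s + b < a + y div s"
    using that by (intro entry grid(3)[OF div div])
qed

text \<open>
  As the columns of \<open>T\<close> beyond the first \<open>s * a\<close> vanish, \<open>T J\<^sub>b\<close> only sees the leading part \<open>J\<^sub>a\<close> of
  \<open>J\<^sub>b\<close>, so that the square part of \<open>T\<close> inherits the intertwining equation.
\<close>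
lemma gen_jordan_intertwine_wide:
  fixes p :: "'a :: field poly"
  defines "s \<equiv> degree p"
  assumes p: "lead_coeff p = 1" "separable p"
    and T: "T \<in> carrier_mat (s * a) (s * b)"
    and JT: "gen_jordan_block p a * T = T * gen_jordan_block p b"
    and ab: "a < b"
  shows "\<exists>Y \<in> centralizer_mat (gen_jordan_block p a). T = append_cols Y (0\<^sub>m (s * a) (s * (b - a)))"
proof -
  let ?Ja = "gen_jordan_block p a" and ?Jb = "gen_jordan_block p b"
  define Y where "Y = mat (s * a) (s * a) (\<lambda>(u, v). T $$ (u, v))"
  have Y: "Y \<in> carrier_mat (s * a) (s * a)" by (simp add: Y_def)
  have Ja: "?Ja \<in> carrier_mat (s * a) (s * a)" and Jb: "?Jb \<in> carrier_mat (s * b) (s * b)"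
    unfolding s_def by (rule gen_jordan_block_carrier)+
  have le: "s * a \<le> s * b" using ab by (intro mult_le_mono2) simp
  have zero: "T $$ (u, w) = 0" if "u < s * a" "s * a \<le> w" "w < s * b" for u w
  proof -
    have "s > 0" using that(1) by (cases s) auto
    then have "u div s < a" "a \<le> w div s"
      using that by (simp_all add: less_mult_imp_div_less mult.commute less_eq_div_iff_mult_less_eq)
    then show ?thesis using gen_jordan_intertwine(2)[OF p T[unfolded s_def] JT] that by (simp add: s_def)
  qed
  have "?Ja * Y = Y * ?Ja"
  proof (rule eq_matI)
    fix u v assume "u < dim_row (Y * ?Ja)" "v < dim_col (Y * ?Ja)"
    then have uv: "u < s * a" "v < s * a" using Y Ja by (simp_all only: index_mult_mat carrier_matD)
    have v': "v < s * b" using uv(2) le by (rule less_le_trans)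
    have "(?Ja * Y) $$ (u, v) = (?Ja * T) $$ (u, v)"
      unfolding mult_mat_index_sum[OF Ja Y uv] mult_mat_index_sum[OF Ja T uv(1) v']
      using uv by (simp add: Y_def)
    also have "\<dots> = (\<Sum>w<s * b. T $$ (u, w) * ?Jb $$ (w, v))"
      unfolding JT by (rule mult_mat_index_sum[OF T Jb uv(1) v'])
    also have "\<dots> = (\<Sum>w<s * a. T $$ (u, w) * ?Jb $$ (w, v))"
      using le uv zero by (intro sum.mono_neutral_right) auto
    also have "\<dots> = (\<Sum>w<s * a. Y $$ (u, w) * ?Ja $$ (w, v))"
      using uv ab by (intro sum.cong refl) (simp add: Y_def gen_jordan_block_leading s_def)
    also have "\<dots> = (Y * ?Ja) $$ (u, v)" by (rule mult_mat_index_sum[OF Y Ja uv, symmetric])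
    finally show "(?Ja * Y) $$ (u, v) = (Y * ?Ja) $$ (u, v)" .
  qed (use Y Ja in \<open>simp_all only: index_mult_mat carrier_matD\<close>)
  then have "Y \<in> centralizer_mat ?Ja" using Y Ja by (simp add: centralizer_mat_def)
  moreover have "T = append_cols Y (0\<^sub>m (s * a) (s * (b - a)))"
  proof (rule eq_matI)
    have w: "s * a + s * (b - a) = s * b" using ab by (simp add: distrib_left[symmetric])
    show "dim_row T = dim_row (append_cols Y (0\<^sub>m (s * a) (s * (b - a))))"
      "dim_col T = dim_col (append_cols Y (0\<^sub>m (s * a) (s * (b - a))))"
      using T w by (auto simp: append_cols_def Y_def)
    fix i j assume "i < dim_row (append_cols Y (0\<^sub>m (s * a) (s * (b - a))))"
      "j < dim_col (append_cols Y (0\<^sub>m (s * a) (s * (b - a))))"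
    then have "i < s * a" "j < s * b" using w by (auto simp: append_cols_def Y_def)
    then show "T $$ (i, j) = append_cols Y (0\<^sub>m (s * a) (s * (b - a))) $$ (i, j)"
      using zero w by (auto simp: append_cols_def Y_def)
  qed
  ultimately show ?thesis by blast
qed

text \<open>
  Dually, the first \<open>s * (a - b)\<close> rows of \<open>T\<close> vanish and \<open>J\<^sub>a T\<close> only sees the trailing part \<open>J\<^sub>b\<close> of \<open>J\<^sub>a\<close>.
\<close>
lemma gen_jordan_intertwine_tall:
  fixes p :: "'a :: field poly"
  defines "s \<equiv> degree p"
  assumes p: "lead_coeff p = 1" "separable p"
    and T: "T \<in> carrier_mat (s * a) (s * b)"
    and JT: "gen_jordan_block p a * T = T * gen_jordan_block p b"
    and ab: "b < a"
  shows "\<exists>Y \<in> centralizer_mat (gen_jordan_block p b). T = 0\<^sub>m (s * (a - b)) (s * b) @\<^sub>r Y"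
proof -
  let ?Ja = "gen_jordan_block p a" and ?Jb = "gen_jordan_block p b" and ?d = "s * (a - b)"
  define Y where "Y = mat (s * b) (s * b) (\<lambda>(u, v). T $$ (?d + u, v))"
  have Y: "Y \<in> carrier_mat (s * b) (s * b)" by (simp add: Y_def)
  have Ja: "?Ja \<in> carrier_mat (s * a) (s * a)" and Jb: "?Jb \<in> carrier_mat (s * b) (s * b)"
    unfolding s_def by (rule gen_jordan_block_carrier)+
  have d: "?d + s * b = s * a" using ab by (simp add: distrib_left[symmetric])
  have zero: "T $$ (w, v) = 0" if "w < ?d" "v < s * b" for w v
  proof -
    have "w div s < a - b" using that(1) by (simp add: less_mult_imp_div_less mult.commute)
    then have "w div s + b < a + v div s" by simp
    moreover have "w < s * a" using that(1) d by linarith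
    ultimately show ?thesis
      using gen_jordan_intertwine(3)[OF p T[unfolded s_def] JT] that by (simp add: s_def)
  qed
  have "?Jb * Y = Y * ?Jb"
  proof (rule eq_matI)
    fix u v assume "u < dim_row (Y * ?Jb)" "v < dim_col (Y * ?Jb)"
    then have uv: "u < s * b" "v < s * b" using Y Jb by (simp_all only: index_mult_mat carrier_matD)
    then have u': "?d + u < s * a" using d by linarith
    have "(?Jb * Y) $$ (u, v) = (\<Sum>w<s * b. ?Ja $$ (?d + u, ?d + w) * T $$ (?d + w, v))"
      unfolding mult_mat_index_sum[OF Jb Y uv]
      using uv ab gen_jordan_block_trailing[of u p b _ "a - b"]
      by (intro sum.cong refl) (simp add: Y_def s_def)
    also have "\<dots> = (\<Sum>w<s * a. if ?d \<le> w \<and> w < ?d + s * b then ?Ja $$ (?d + u, w) * T $$ (w, v) else 0)"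
      by (rule sum_lessThan_window[symmetric]) (simp add: d)
    also have "\<dots> = (\<Sum>w<s * a. ?Ja $$ (?d + u, w) * T $$ (w, v))"
    proof (rule sum.cong[OF refl])
      fix w assume "w \<in> {..<s * a}"
      then have "w < ?d + s * b" unfolding d by simp
      then show "(if ?d \<le> w \<and> w < ?d + s * b then ?Ja $$ (?d + u, w) * T $$ (w, v) else 0)
        = ?Ja $$ (?d + u, w) * T $$ (w, v)"
        using zero[of w v] uv by (cases "?d \<le> w") simp_all
    qed
    also have "\<dots> = (T * ?Jb) $$ (?d + u, v)"
      unfolding JT[symmetric] by (rule mult_mat_index_sum[OF Ja T u' uv(2), symmetric])
    also have "\<dots> = (Y * ?Jb) $$ (u, v)"
      unfolding mult_mat_index_sum[OF T Jb u' uv(2)] mult_mat_index_sum[OF Y Jb uv]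
      using uv by (simp add: Y_def)
    finally show "(?Jb * Y) $$ (u, v) = (Y * ?Jb) $$ (u, v)" .
  qed (use Y Jb in \<open>simp_all only: index_mult_mat carrier_matD\<close>)
  then have "Y \<in> centralizer_mat ?Jb" using Y Jb by (simp add: centralizer_mat_def)
  moreover have "T = 0\<^sub>m ?d (s * b) @\<^sub>r Y"
  proof (rule eq_matI)
    show "dim_row T = dim_row (0\<^sub>m ?d (s * b) @\<^sub>r Y)" "dim_col T = dim_col (0\<^sub>m ?d (s * b) @\<^sub>r Y)"
      using T d by (auto simp: append_rows_def Y_def)
    fix i j assume "i < dim_row (0\<^sub>m ?d (s * b) @\<^sub>r Y)" "j < dim_col (0\<^sub>m ?d (s * b) @\<^sub>r Y)"
    then have "i < s * a" "j < s * b" using d by (auto simp: append_rows_def Y_def)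
    then show "T $$ (i, j) = (0\<^sub>m ?d (s * b) @\<^sub>r Y) $$ (i, j)"
      using zero d by (auto simp: append_rows_def Y_def)
  qed
  ultimately show ?thesis by blast
qed

section \<open>Block structure of the centralizer\<close>

theorem theorem5p6:
  fixes p :: "'a :: field poly"
    and \<alpha> :: "nat list"
    and r r\<^sub>1 s m :: nat
    and G X :: "'a mat"
    and XX :: "nat \<Rightarrow> nat \<Rightarrow> 'a mat"
  assumes "lead_coeff p = 1" and "irreducible p" and "separable p" and "degree p = s"
    and "length \<alpha> = m" and "sorted_wrt (\<ge>) \<alpha>" and "sum_list \<alpha> = r"
    and "G = gen_jordan_mat p \<alpha>"
    and "char_poly G = p ^ r"
    and "is_minimal_poly G (p ^ r\<^sub>1)" and "r\<^sub>1 \<le> r"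
    and "X \<in> centralizer_mat G"
    and "XX = mat_block (map ((*) s) \<alpha>) (map ((*) s) \<alpha>) X"
  shows "\<forall>i<m. \<forall>j<m.
      XX i j \<in> carrier_mat (s * \<alpha> ! i) (s * \<alpha> ! j) \<and>
      block_lower_toeplitz s (\<alpha> ! i) (\<alpha> ! j) (XX i j) \<and>
      (\<alpha> ! i = \<alpha> ! j \<longrightarrow> XX i j \<in> centralizer_mat (gen_jordan_block p (\<alpha> ! i))) \<and>
      (\<alpha> ! i < \<alpha> ! j \<longrightarrow> (\<exists>Y \<in> centralizer_mat (gen_jordan_block p (\<alpha> ! i)).
         XX i j = append_cols Y (0\<^sub>m (s * \<alpha> ! i) (s * (\<alpha> ! j - \<alpha> ! i))))) \<and>
      (\<alpha> ! i > \<alpha> ! j \<longrightarrow> (\<exists>Y \<in> centralizer_mat (gen_jordan_block p (\<alpha> ! j)).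
         XX i j = 0\<^sub>m (s * (\<alpha> ! i - \<alpha> ! j)) (s * \<alpha> ! j) @\<^sub>r Y))"
proof (intro allI impI)
  note p = assms(1,3) and s = assms(4)
  fix i j assume "i < m" "j < m"
  then have i: "i < length \<alpha>" and j: "j < length \<alpha>" using assms(5) by simp_all
  let ?J = "gen_jordan_block p" and ?As = "map (gen_jordan_block p) \<alpha>"
  have J: "?J a \<in> carrier_mat (s * a) (s * a)" for a
    using gen_jordan_block_carrier[of p a] s by simp
  have dims: "map dim_row ?As = map ((*) s) \<alpha>" using carrier_matD(1)[OF J] by simp
  have sq: "\<forall>A\<in>set ?As. square_mat A" using carrier_matD[OF J] by auto
  have "map dim_col ?As = map ((*) s) \<alpha>" using carrier_matD(2)[OF J] by simp
  then have G: "diag_block_mat ?As \<in> carrier_mat (sum_list (map ((*) s) \<alpha>)) (sum_list (map ((*) s) \<alpha>))"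
    using dims by (intro carrier_matI) (simp_all only: dim_diag_block_mat)
  have X: "X \<in> centralizer_mat (diag_block_mat ?As)"
    using assms(8,12) by (simp add: gen_jordan_mat_def)
  then have "X \<in> carrier_mat (sum_list (map ((*) s) \<alpha>)) (sum_list (map ((*) s) \<alpha>))"
    using carrier_matD[OF G] by (simp add: centralizer_mat_def)
  then have T: "XX i j \<in> carrier_mat (s * \<alpha> ! i) (s * \<alpha> ! j)"
    using i j unfolding assms(13) by (subst mat_block_eq) auto
  have JT: "?J (\<alpha> ! i) * XX i j = XX i j * ?J (\<alpha> ! j)"
    using diag_block_mat_centralizer_block[OF sq X, of i j] i j unfolding dims assms(13) by simp
  note T' = T[folded s]
  have "XX i j \<in> centralizer_mat (?J (\<alpha> ! i))" if "\<alpha> ! i = \<alpha> ! j"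
    using T JT carrier_matD[OF J[of "\<alpha> ! i"]] that by (simp add: centralizer_mat_def)
  then show "XX i j \<in> carrier_mat (s * \<alpha> ! i) (s * \<alpha> ! j) \<and>
      block_lower_toeplitz s (\<alpha> ! i) (\<alpha> ! j) (XX i j) \<and>
      (\<alpha> ! i = \<alpha> ! j \<longrightarrow> XX i j \<in> centralizer_mat (gen_jordan_block p (\<alpha> ! i))) \<and>
      (\<alpha> ! i < \<alpha> ! j \<longrightarrow> (\<exists>Y \<in> centralizer_mat (gen_jordan_block p (\<alpha> ! i)).
         XX i j = append_cols Y (0\<^sub>m (s * \<alpha> ! i) (s * (\<alpha> ! j - \<alpha> ! i))))) \<and>
      (\<alpha> ! i > \<alpha> ! j \<longrightarrow> (\<exists>Y \<in> centralizer_mat (gen_jordan_block p (\<alpha> ! j)).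
         XX i j = 0\<^sub>m (s * (\<alpha> ! i - \<alpha> ! j)) (s * \<alpha> ! j) @\<^sub>r Y))"
    using T gen_jordan_intertwine(1)[OF p T' JT] gen_jordan_intertwine_wide[OF p T' JT]
      gen_jordan_intertwine_tall[OF p T' JT] unfolding s by blast
qed

end
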